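(* For arbitrary integers $r,t\geq 2$, \[f(r,t)< (r+1)^{r+1}(t-1)t^{2r}.\]
   Context: An $r$-graph is an $r$-uniform multi-hypergraph $G=(V,E)$: $V$ is a set of vertices and $E$ is a multiset of $r$-element subsets of $V$. A matching is a set of pairwise disjoint edges; a $t$-matching is a matching of size $t$. An $r$-graph is $r$-partite if its vertex set is a disjoint union $V=V_1\cup\cdots\cup V_r$ of $r$ parts and every edge meets each part in exactly one vertex. An $(f,t)$-colored $r$-graph is an $r$-graph whose edges (members of the multiset $E$, so different copies of the same $r$-set are different edges) are colored with $f$ colors such that every one of the $f$ color classes is a $t$-matching (exactly $t$ pairwise disjoint edges). A rainbow $t$-matching is a set of $t$ pairwise disjoint edges having $t$ distinct colors. $f(r,t)$ denotes the largest $f$ such that there exists an $(f,t)$-colored $r$-partite $r$-graph with no rainbow $t$-matching. *)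

theory Defs
  imports
    "HOL-Library.Multiset"
    "HOL-Library.Disjoint_Sets"
    "HOL-Library.Extended_Nat"
    "HOL-Library.Countable_Set"
begin

definition r_graph :: "nat \<Rightarrow> 'a set \<Rightarrow> 'a set multiset \<Rightarrow> bool" where
  "r_graph r V E \<longleftrightarrow> (\<forall>e\<in>#E. e \<subseteq> V \<and> finite e \<and> card e = r)"

definition r_partite :: "nat \<Rightarrow> 'a set \<Rightarrow> 'a set multiset \<Rightarrow> bool" where
  "r_partite r V E \<longleftrightarrow>
     (\<exists>P :: nat \<Rightarrow> 'a set.
        V = (\<Union>i<r. P i) \<and> disjoint_family_on P {..<r} \<and>
        (\<forall>e\<in>#E. \<forall>i<r. card (e \<inter> P i) = 1))"

text \<open>The pair \<open>(e, k)\<close> stands for the \<open>k\<close>-th copy of the vertex set \<open>e\<close> in the multiset \<open>E\<close>,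
  so that different copies are different edges and may receive different colours.\<close>

definition edges :: "'a set multiset \<Rightarrow> ('a set \<times> nat) set" where
  "edges E = {(e, k). k < count E e}"

definition matching :: "'a set multiset \<Rightarrow> ('a set \<times> nat) set \<Rightarrow> bool" where
  "matching E M \<longleftrightarrow> M \<subseteq> edges E \<and> pairwise (\<lambda>x y. disjnt (fst x) (fst y)) M"

definition t_matching :: "nat \<Rightarrow> 'a set multiset \<Rightarrow> ('a set \<times> nat) set \<Rightarrow> bool" where
  "t_matching t E M \<longleftrightarrow> matching E M \<and> finite M \<and> card M = t"

definition ft_colored :: "nat \<Rightarrow> nat \<Rightarrow> 'a set multiset \<Rightarrow> ('a set \<times> nat \<Rightarrow> nat) \<Rightarrow> bool" where
  "ft_colored f t E c \<longleftrightarrow>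
     c ` edges E \<subseteq> {..<f} \<and> (\<forall>i<f. t_matching t E {x \<in> edges E. c x = i})"

definition rainbow_matching ::
    "nat \<Rightarrow> 'a set multiset \<Rightarrow> ('a set \<times> nat \<Rightarrow> nat) \<Rightarrow> ('a set \<times> nat) set \<Rightarrow> bool" where
  "rainbow_matching t E c M \<longleftrightarrow> t_matching t E M \<and> inj_on c M"

definition rainbow_free_example ::
    "nat \<Rightarrow> nat \<Rightarrow> nat \<Rightarrow> 'a set \<Rightarrow> 'a set multiset \<Rightarrow> ('a set \<times> nat \<Rightarrow> nat) \<Rightarrow> bool" where
  "rainbow_free_example r t f V E c \<longleftrightarrow>
     r_graph r V E \<and> r_partite r V E \<and> ft_colored f t E c \<and> \<not> (\<exists>M. rainbow_matching t E c M)"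

text \<open>The largest number of colours, with value \<open>\<infinity>\<close> if the number of colours is unbounded;
  lemma \<open>max_colors_eq_enat_iff\<close> shows that a finite value is an attained maximum. Taking the
  vertices from \<^typ>\<open>nat\<close> loses nothing, see lemma \<open>rainbow_free_example_nat\<close>.\<close>

definition max_colors :: "nat \<Rightarrow> nat \<Rightarrow> enat" where
  "max_colors r t =
     Sup {enat f | f. \<exists>(V :: nat set) E c. rainbow_free_example r t f V E c}"

lemma finite_edges: "finite (edges E)"
proof -
  have "edges E = (SIGMA e:set_mset E. {..<count E e})"
    by (auto simp: edges_def simp flip: count_greater_zero_iff)
  then show ?thesis by simp
qed

lemma rainbow_free_example_0:
  assumes "t > 0"
  shows "rainbow_free_example r t 0 ({} :: nat set) {#} (\<lambda>_. 0)"
  using assms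
  by (auto simp: rainbow_free_example_def r_graph_def r_partite_def ft_colored_def
      rainbow_matching_def t_matching_def matching_def edges_def disjoint_family_on_def
      intro!: exI[of _ "\<lambda>_. {}"])

lemma max_colors_eq_enat_iff:
  assumes "t > 0"
  shows "max_colors r t = enat n \<longleftrightarrow>
    (\<exists>(V :: nat set) E c. rainbow_free_example r t n V E c) \<and>
    (\<forall>f. (\<exists>(V :: nat set) E c. rainbow_free_example r t f V E c) \<longrightarrow> f \<le> n)"
proof -
  define S where "S = {f. \<exists>(V :: nat set) E c. rainbow_free_example r t f V E c}"
  have m: "max_colors r t = Sup (enat ` S)"
    unfolding max_colors_def S_def by (rule arg_cong[where f = Sup]) auto
  have ne: "S \<noteq> {}"
    using rainbow_free_example_0[OF assms] unfolding S_def by blast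
  have "Sup (enat ` S) = enat n \<longleftrightarrow> n \<in> S \<and> (\<forall>f\<in>S. f \<le> n)"
  proof
    assume eq: "Sup (enat ` S) = enat n"
    have le: "\<forall>f\<in>S. f \<le> n"
      using eq by (metis Sup_upper enat_ord_simps(1) imageI)
    then have fin: "finite S"
      using finite_nat_set_iff_bounded_le by blast
    then have "Sup (enat ` S) = Max (enat ` S)"
      using ne by (simp add: Sup_enat_def)
    then have "enat n \<in> enat ` S"
      using eq Max_in[of "enat ` S"] fin ne by simp
    then show "n \<in> S \<and> (\<forall>f\<in>S. f \<le> n)" using le by auto
  next
    assume "n \<in> S \<and> (\<forall>f\<in>S. f \<le> n)"
    then show "Sup (enat ` S) = enat n"
      by (intro antisym Sup_least Sup_upper) auto
  qed
  then show ?thesis unfolding m S_def by blast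
qed

lemma rainbow_free_example_nat:
  fixes V :: "'a set"
  assumes ex: "rainbow_free_example r t f V E c"
  shows "\<exists>(V' :: nat set) E' c'. rainbow_free_example r t f V' E' c'"
proof -
  from ex have rg: "r_graph r V E" and rp: "r_partite r V E"
    and col: "ft_colored f t E c" and norb: "\<not> (\<exists>M. rainbow_matching t E c M)"
    by (auto simp: rainbow_free_example_def)
  define W where "W = \<Union> (set_mset E)"
  have "finite W" using rg by (auto simp: W_def r_graph_def)
  define h :: "'a \<Rightarrow> nat" where "h = to_nat_on W"
  have h: "inj_on h W"
    using \<open>finite W\<close> unfolding h_def by (intro inj_on_to_nat_on countable_finite)
  have sub: "e \<subseteq> W" if "e \<in># E" for e using that by (auto simp: W_def)
  have W_V: "W \<subseteq> V" using rg by (auto simp: W_def r_graph_def)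
  define g where "g = (`) h"
  have g: "inj_on g (set_mset E)"
    unfolding g_def by (rule inj_on_subset[OF inj_on_image_Pow[OF h]]) (use sub in blast)
  define E' where "E' = image_mset g E"
  define V' where "V' = h ` W"
  define \<phi> where "\<phi> = (\<lambda>x :: 'a set \<times> nat. (g (fst x), snd x))"
  define c' where "c' = c \<circ> inv_into (edges E) \<phi>"
  have mem: "fst x \<in># E" if "x \<in> edges E" for x
    using that by (auto simp: edges_def simp flip: count_greater_zero_iff)
  have cnt: "count E' (g e) = count E e" if "e \<in># E" for e
  proof -
    have "count E' (g e) = sum (count E) {e}"
      unfolding E'_def count_image_mset
      by (rule sum.cong) (use that inj_onD[OF g, of _ e] in auto)
    then show ?thesis by simp
  qed
  have inj\<phi>: "inj_on \<phi> (edges E)"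
  proof (rule inj_onI)
    fix x y assume xy: "x \<in> edges E" "y \<in> edges E" "\<phi> x = \<phi> y"
    then have "fst x = fst y"
      using inj_onD[OF g, of "fst x" "fst y"] mem by (simp add: \<phi>_def)
    with xy show "x = y" by (simp add: \<phi>_def prod_eq_iff)
  qed
  have img: "\<phi> ` edges E = edges E'"
  proof (intro equalityI subsetI)
    fix y assume "y \<in> \<phi> ` edges E"
    then obtain x where x: "x \<in> edges E" "y = \<phi> x" by blast
    then show "y \<in> edges E'"
      using cnt[OF mem[OF x(1)]] by (simp add: \<phi>_def edges_def split_beta)
  next
    fix y assume y: "y \<in> edges E'"
    obtain d k where yk: "y = (d, k)" by (cases y)
    have "k < count E' d" using y yk by (simp add: edges_def)
    then have "d \<in># E'" by (metis count_eq_zero_iff not_less_zero)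
    then obtain e where e: "e \<in># E" "d = g e" by (auto simp: E'_def)
    then have "(e, k) \<in> edges E" using \<open>k < count E' d\<close> cnt by (simp add: edges_def)
    moreover have "y = \<phi> (e, k)" using yk e by (simp add: \<phi>_def)
    ultimately show "y \<in> \<phi> ` edges E" by blast
  qed
  have c': "c' (\<phi> x) = c x" if "x \<in> edges E" for x
    using that inj\<phi> by (simp add: c'_def)
  have disj: "disjnt (fst (\<phi> x)) (fst (\<phi> y)) \<longleftrightarrow> disjnt (fst x) (fst y)"
    if "x \<in> edges E" "y \<in> edges E" for x y
    using inj_on_image_Int[OF h sub[OF mem[OF that(1)]] sub[OF mem[OF that(2)]]]
    by (auto simp: disjnt_def \<phi>_def g_def)
  have tm: "t_matching t E' (\<phi> ` M) \<longleftrightarrow> t_matching t E M" if M: "M \<subseteq> edges E" for M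
  proof -
    have i: "inj_on \<phi> M" using inj\<phi> M by (rule inj_on_subset)
    have "pairwise (\<lambda>x y. disjnt (fst x) (fst y)) (\<phi> ` M) \<longleftrightarrow>
        pairwise (\<lambda>x y. disjnt (fst x) (fst y)) M"
      using disj[OF subsetD[OF M] subsetD[OF M]] inj_on_eq_iff[OF i]
      by (simp add: pairwise_def)
    moreover have "\<phi> ` M \<subseteq> edges E'" using M img by blast
    ultimately show ?thesis
      using M i by (simp add: t_matching_def matching_def card_image finite_image_iff)
  qed
  have "r_graph r V' E'"
    unfolding r_graph_def
  proof
    fix d assume "d \<in># E'"
    then obtain e where e: "e \<in># E" "d = h ` e" by (auto simp: E'_def g_def)
    moreover have "card (h ` e) = card e"
      using sub[OF e(1)] by (intro card_image inj_on_subset[OF h])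
    ultimately show "d \<subseteq> V' \<and> finite d \<and> card d = r"
      using rg sub[OF e(1)] by (auto simp: r_graph_def V'_def)
  qed
  moreover have "r_partite r V' E'"
  proof -
    from rp obtain P where P: "V = (\<Union>i<r. P i)" "disjoint_family_on P {..<r}"
        "\<forall>e\<in>#E. \<forall>i<r. card (e \<inter> P i) = 1"
      by (auto simp: r_partite_def)
    define Q where "Q = (\<lambda>i. h ` (W \<inter> P i))"
    have "W = (\<Union>i<r. W \<inter> P i)" using W_V P(1) by blast
    then have "V' = (\<Union>i<r. Q i)" unfolding V'_def Q_def image_UN[symmetric] by (rule arg_cong)
    moreover have "disjoint_family_on Q {..<r}"
      unfolding disjoint_family_on_def Q_def
    proof (intro ballI impI)
      fix i j assume "i \<in> {..<r}" "j \<in> {..<r}" "i \<noteq> j"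
      then have "P i \<inter> P j = {}" using P(2) by (simp add: disjoint_family_on_def)
      then have "(W \<inter> P i) \<inter> (W \<inter> P j) = {}" by blast
      moreover have "h ` ((W \<inter> P i) \<inter> (W \<inter> P j)) = h ` (W \<inter> P i) \<inter> h ` (W \<inter> P j)"
        by (rule inj_on_image_Int[OF h]) auto
      ultimately show "h ` (W \<inter> P i) \<inter> h ` (W \<inter> P j) = {}" by simp
    qed
    moreover have "card (d \<inter> Q i) = 1" if "d \<in># E'" "i < r" for d i
    proof -
      from that obtain e where e: "e \<in># E" "d = h ` e" by (auto simp: E'_def g_def)
      have "d \<inter> Q i = h ` (e \<inter> (W \<inter> P i))"
        unfolding Q_def e(2) by (rule inj_on_image_Int[OF h sub[OF e(1)], symmetric]) simp
      also have "e \<inter> (W \<inter> P i) = e \<inter> P i" using sub[OF e(1)] by auto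
      also have "card (h ` \<dots>) = card (e \<inter> P i)"
        using sub[OF e(1)] by (intro card_image inj_on_subset[OF h]) auto
      finally show ?thesis using P(3) e that by simp
    qed
    ultimately show ?thesis unfolding r_partite_def by blast
  qed
  moreover have "ft_colored f t E' c'"
  proof -
    have cls: "{y \<in> edges E'. c' y = i} = \<phi> ` {x \<in> edges E. c x = i}" for i
      using c' by (auto simp: img[symmetric])
    have "c' ` edges E' \<subseteq> {..<f}"
      using col c' by (auto simp: img[symmetric] ft_colored_def)
    moreover have "t_matching t E' {y \<in> edges E'. c' y = i}" if "i < f" for i
      unfolding cls using col that by (subst tm) (auto simp: ft_colored_def)
    ultimately show ?thesis by (simp add: ft_colored_def)
  qed
  moreover have "\<not> rainbow_matching t E' c' N" for N
  proof
    assume N: "rainbow_matching t E' c' N"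
    then have "N \<subseteq> \<phi> ` edges E"
      by (auto simp: img rainbow_matching_def t_matching_def matching_def)
    then obtain M where M: "M \<subseteq> edges E" "N = \<phi> ` M" by (auto simp: subset_image_iff)
    have "inj_on c M"
    proof (rule inj_onI)
      fix x y assume xy: "x \<in> M" "y \<in> M" "c x = c y"
      then have "c' (\<phi> x) = c' (\<phi> y)" using c'[OF subsetD[OF M(1)]] by simp
      then have "\<phi> x = \<phi> y"
        using N xy M(2) by (auto simp: rainbow_matching_def dest: inj_onD)
      then show "x = y" using inj_onD[OF inj\<phi>, of x y] M(1) xy by blast
    qed
    then show False using norb N M(2) tm[OF M(1)] by (auto simp: rainbow_matching_def)
  qed
  ultimately show ?thesis unfolding rainbow_free_example_def by blast
qed

end

theory Submission
  imports Defs
begin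

text \<open>
  The idea is to look at sets of vertices from which an edge can be grown very freely. Call \<open>S\<close>
  extendable if, whatever few vertices outside \<open>S\<close> and whatever few colours are forbidden, some
  edge through \<open>S\<close> avoids all of them; here ``few'' means \<open>r (t - 1)\<close> vertices and \<open>t - 1\<close>
  colours, which is what \<open>t - 1\<close> other edges can occupy.

  Pairwise disjoint extendable sets \<open>S\<^sub>1, \<dots>, S\<^sub>t\<close> yield a rainbow \<open>t\<close>-matching: replace them one
  after the other by edges that avoid the edges chosen before, their colours, and the sets still
  waiting (lemma \<open>rainbow_extension\<close>). So, without a rainbow \<open>t\<close>-matching, no colour class can
  consist of \<open>t\<close> edges that all contain an extendable set, and every colour has an edge with no
  extendable subset at all.

  There are only few colours with such an edge. If \<open>S\<close> is not extendable, then a set \<open>W\<close> of at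
  most \<open>r (t - 1)\<close> vertices outside \<open>S\<close> meets all edges through \<open>S\<close>, up to at most \<open>t - 1\<close>
  colours. Branching over the vertices of \<open>W\<close>, from the empty set up to sets of size \<open>r\<close>, shows
  that there are at most \<open>(t - 1) (r (t - 1) + 1)\<^sup>r\<close> of these colours (lemma
  \<open>card_unextendable_le\<close>). This is less than the required bound.
\<close>

definition extendable ::
    "nat \<Rightarrow> nat \<Rightarrow> ('a set \<times> nat) set \<Rightarrow> ('a set \<times> nat \<Rightarrow> nat) \<Rightarrow> 'a set \<Rightarrow> bool" where
  "extendable n m X c S \<longleftrightarrow>
     (\<forall>W C. finite W \<and> card W \<le> n \<and> disjnt S W \<and> finite C \<and> card C \<le> m \<longrightarrow>
        (\<exists>x\<in>X. S \<subseteq> fst x \<and> disjnt (fst x) W \<and> c x \<notin> C))"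

text \<open>
  The induction descends from sets of size \<open>r\<close>. An edge equal to \<open>S\<close> avoids every set outside
  \<open>S\<close>, so it is caught by one of the \<open>m\<close> forbidden colours. For smaller \<open>S\<close>, an edge not caught by
  a forbidden colour passes through one of \<open>n\<close> sets \<open>insert v S\<close>, whence the recursion
  \<open>b (k + 1) = m + n b k\<close>, which \<open>m (n + 1)\<^sup>k\<close> dominates.
\<close>
lemma card_unextendable_le:
  assumes "finite Y" "Y \<subseteq> X" "inj_on c Y"
    and card_Y: "\<And>y. y \<in> Y \<Longrightarrow> finite (fst y) \<and> card (fst y) = r"
    and unext: "\<And>y T. y \<in> Y \<Longrightarrow> T \<subseteq> fst y \<Longrightarrow> \<not> extendable n m X c T"
    and "finite S" "card S + k = r"
  shows "card {y \<in> Y. S \<subseteq> fst y} \<le> m * (n + 1) ^ k"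
  using \<open>finite S\<close> \<open>card S + k = r\<close>
proof (induction k arbitrary: S)
  case (0 S)
  show ?case
  proof (cases "{y \<in> Y. S \<subseteq> fst y} = {}")
    case False
    then have "\<not> extendable n m X c S" using unext by blast
    then obtain W C where WC: "disjnt S W" "finite C" "card C \<le> m"
        "\<And>x. x \<in> X \<Longrightarrow> S \<subseteq> fst x \<Longrightarrow> disjnt (fst x) W \<Longrightarrow> c x \<in> C"
      unfolding extendable_def by blast
    have "c ` {y \<in> Y. S \<subseteq> fst y} \<subseteq> C"
    proof safe
      fix y assume y: "y \<in> Y" "S \<subseteq> fst y"
      then have "S = fst y" using card_Y[OF y(1)] 0 by (intro card_subset_eq) auto
      then show "c y \<in> C" using WC(1) WC(4)[of y] y \<open>Y \<subseteq> X\<close> by auto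
    qed
    then have "card {y \<in> Y. S \<subseteq> fst y} \<le> card C"
      using WC(2) inj_on_subset[OF \<open>inj_on c Y\<close>] by (intro card_inj_on_le[of c]) auto
    then show ?thesis using WC(3) by simp
  qed (simp only: card.empty)
next
  case (Suc k S)
  show ?case
  proof (cases "{y \<in> Y. S \<subseteq> fst y} = {}")
    case False
    then have "\<not> extendable n m X c S" using unext by blast
    then obtain W C where WC: "finite W" "card W \<le> n" "disjnt S W" "finite C" "card C \<le> m"
        "\<And>x. x \<in> X \<Longrightarrow> S \<subseteq> fst x \<Longrightarrow> disjnt (fst x) W \<Longrightarrow> c x \<in> C"
      unfolding extendable_def by blast
    define caught where "caught = {y \<in> Y. c y \<in> C}"
    define through where "through = (\<lambda>v. {y \<in> Y. insert v S \<subseteq> fst y})"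
    have fin: "finite caught" "finite (through v)" for v
      using \<open>finite Y\<close> by (auto simp: caught_def through_def)
    have "card caught \<le> card C"
      using WC(4) inj_on_subset[OF \<open>inj_on c Y\<close>]
      by (intro card_inj_on_le[of c]) (auto simp: caught_def)
    then have caught: "card caught \<le> m" using WC(5) by simp
    have through: "card (through v) \<le> m * (n + 1) ^ k" if "v \<in> W" for v
    proof -
      have "v \<notin> S" using that WC(3) by (auto simp: disjnt_def)
      then show ?thesis unfolding through_def using Suc.prems by (intro Suc.IH) auto
    qed
    have "{y \<in> Y. S \<subseteq> fst y} \<subseteq> caught \<union> (\<Union>v\<in>W. through v)"
      using WC(6) \<open>Y \<subseteq> X\<close> by (auto simp: caught_def through_def disjnt_def)
    then have "card {y \<in> Y. S \<subseteq> fst y} \<le> card (caught \<union> (\<Union>v\<in>W. through v))"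
      using fin WC(1) by (intro card_mono) auto
    also have "\<dots> \<le> card caught + card (\<Union>v\<in>W. through v)"
      by (rule card_Un_le)
    also have "card (\<Union>v\<in>W. through v) \<le> (\<Sum>v\<in>W. card (through v))"
      by (rule card_UN_le[OF WC(1)])
    also have "\<dots> \<le> card W * (m * (n + 1) ^ k)"
      using sum_bounded_above[OF through, of W] by simp
    also have "\<dots> \<le> n * (m * (n + 1) ^ k)"
      by (rule mult_le_mono1[OF WC(2)])
    also have "card caught \<le> m * (n + 1) ^ k"
      using caught by (rule order_trans) simp
    finally show ?thesis by (simp add: algebra_simps)
  qed (simp only: card.empty)
qed

text \<open>
  The greedy choice needs an invariant: the edges chosen so far avoid not only each other but also
  the sets \<open>S j\<close> that are still to be extended. Otherwise the vertices to be avoided at a later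
  step might meet \<open>S j\<close>, and extendability of \<open>S j\<close> would say nothing.
\<close>
lemma rainbow_extension:
  assumes "finite I"
    and card_X: "\<And>x. x \<in> X \<Longrightarrow> finite (fst x) \<and> card (fst x) \<le> r"
    and ext: "\<And>i. i \<in> I \<Longrightarrow> extendable (r * (card I - 1)) (card I - 1) X c (S i)"
    and fin_S: "\<And>i. i \<in> I \<Longrightarrow> finite (S i) \<and> card (S i) \<le> r"
    and disj: "\<And>i j. i \<in> I \<Longrightarrow> j \<in> I \<Longrightarrow> i \<noteq> j \<Longrightarrow> disjnt (S i) (S j)"
  obtains g where "g ` I \<subseteq> X" "inj_on (c \<circ> g) I"
    "pairwise (\<lambda>i j. disjnt (fst (g i)) (fst (g j))) I"
proof -
  have "\<exists>g. g ` K \<subseteq> X \<and> inj_on (c \<circ> g) K \<and>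
      pairwise (\<lambda>i j. disjnt (fst (g i)) (fst (g j))) K \<and>
      (\<forall>i\<in>K. \<forall>j\<in>I - K. disjnt (fst (g i)) (S j))" if "K \<subseteq> I" for K
    using finite_subset[OF that \<open>finite I\<close>] that
  proof (induction K rule: finite_induct)
    case empty
    then show ?case by simp
  next
    case (insert a K)
    then obtain g where g: "g ` K \<subseteq> X" "inj_on (c \<circ> g) K"
        "pairwise (\<lambda>i j. disjnt (fst (g i)) (fst (g j))) K"
        "\<forall>i\<in>K. \<forall>j\<in>I - K. disjnt (fst (g i)) (S j)"
      by (metis insert_subset)
    define U where "U = (\<lambda>i. if i \<in> K then fst (g i) else S i)"
    define W where "W = (\<Union>i\<in>I - {a}. U i)"
    have a: "a \<in> I" "a \<notin> K" and K: "K \<subseteq> I - {a}" using insert by auto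
    have U: "finite (U i) \<and> card (U i) \<le> r" if "i \<in> I - {a}" for i
      using that card_X[of "g i"] fin_S[of i] g(1) by (auto simp: U_def)
    have "card W \<le> (\<Sum>i\<in>I - {a}. card (U i))"
      unfolding W_def using \<open>finite I\<close> by (intro card_UN_le) simp
    also have "\<dots> \<le> card (I - {a}) * r"
      using sum_bounded_above[of "I - {a}" "\<lambda>i. card (U i)" r] U by simp
    finally have "card W \<le> r * (card I - 1)"
      using a(1) \<open>finite I\<close> by (simp add: mult.commute)
    moreover have "finite W" unfolding W_def using \<open>finite I\<close> U by blast
    moreover have "disjnt (S a) W"
      using g(4) disj a by (fastforce simp: W_def U_def disjnt_def)
    moreover have "card ((c \<circ> g) ` K) \<le> card I - 1"
    proof -
      have "card ((c \<circ> g) ` K) \<le> card K" by (rule card_image_le[OF insert.hyps(1)])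
      also have "\<dots> \<le> card (I - {a})" using K \<open>finite I\<close> by (intro card_mono) auto
      finally show ?thesis using a(1) \<open>finite I\<close> by simp
    qed
    moreover have "finite ((c \<circ> g) ` K)" using insert.hyps(1) by blast
    ultimately obtain x where x: "x \<in> X" "disjnt (fst x) W" "c x \<notin> (c \<circ> g) ` K"
      using ext[OF a(1)] unfolding extendable_def by metis
    have x_g: "disjnt (fst x) (fst (g i))" if "i \<in> K" for i
    proof -
      have "U i \<subseteq> W" using that K by (auto simp: W_def)
      then show ?thesis using x(2) that by (auto simp: U_def disjnt_def)
    qed
    have x_S: "disjnt (fst x) (S j)" if "j \<in> I - insert a K" for j
    proof -
      have "U j \<subseteq> W" using that by (auto simp: W_def)
      then show ?thesis using x(2) that by (auto simp: U_def disjnt_def)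
    qed
    define h where "h = g(a := x)"
    have h_a: "h a = x" by (simp add: h_def)
    have h_K: "h i = g i" if "i \<in> K" for i using that a(2) by (auto simp: h_def)
    show ?case
    proof (intro exI[of _ h] conjI)
      show "h ` insert a K \<subseteq> X"
        using g(1) x(1) h_a h_K by (metis image_cong image_insert insert_subset)
      have "inj_on (c \<circ> h) K"
        using g(2) h_K unfolding inj_on_def o_apply by metis
      moreover have "(c \<circ> h) ` K = (c \<circ> g) ` K"
        using h_K by (intro image_cong) simp_all
      ultimately show "inj_on (c \<circ> h) (insert a K)"
        unfolding inj_on_insert using x(3) h_a a(2) by simp
      show "pairwise (\<lambda>i j. disjnt (fst (h i)) (fst (h j))) (insert a K)"
      proof (rule pairwiseI)
        fix i j assume ij: "i \<in> insert a K" "j \<in> insert a K" "i \<noteq> j"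
        then consider "i = a" "j \<in> K" | "i \<in> K" "j = a" | "i \<in> K" "j \<in> K"
          by blast
        then show "disjnt (fst (h i)) (fst (h j))"
        proof cases
          case 1
          then show ?thesis using x_g h_a h_K by simp
        next
          case 2
          then show ?thesis using x_g[of i] h_a h_K by (simp add: disjnt_sym)
        next
          case 3
          then show ?thesis using pairwiseD[OF g(3) _ _ ij(3)] h_K by simp
        qed
      qed
      show "\<forall>i\<in>insert a K. \<forall>j\<in>I - insert a K. disjnt (fst (h i)) (S j)"
      proof (intro ballI)
        fix i j assume "i \<in> insert a K" and j: "j \<in> I - insert a K"
        then consider "i = a" | "i \<in> K" by blast
        then show "disjnt (fst (h i)) (S j)"
        proof cases
          case 1
          then show ?thesis using x_S[OF j] h_a by simp
        next
          case 2
          then show ?thesis using g(4) j h_K by simp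
        qed
      qed
    qed
  qed
  from this[of I] show thesis using that by auto
qed

lemma rainbow_free_example_le:
  assumes ex: "rainbow_free_example r t f V E c"
  shows "f \<le> (t - 1) * (r * (t - 1) + 1) ^ r"
proof -
  let ?ext = "extendable (r * (t - 1)) (t - 1) (edges E) c"
  have edge: "finite (fst x) \<and> card (fst x) = r" if "x \<in> edges E" for x
    using that ex
    by (auto simp: rainbow_free_example_def r_graph_def edges_def simp flip: count_greater_zero_iff)
  have "\<exists>x\<in>edges E. c x = i \<and> (\<forall>T. T \<subseteq> fst x \<longrightarrow> \<not> ?ext T)" if "i < f" for i
  proof (rule ccontr)
    assume no: "\<not> ?thesis"
    define M where "M = {x \<in> edges E. c x = i}"
    have M: "finite M" "card M = t" "pairwise (\<lambda>x y. disjnt (fst x) (fst y)) M"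
      using ex that
      by (auto simp: rainbow_free_example_def ft_colored_def t_matching_def matching_def M_def)
    from no have "\<forall>x\<in>M. \<exists>T. T \<subseteq> fst x \<and> ?ext T" by (auto simp: M_def)
    then obtain S where S: "\<And>x. x \<in> M \<Longrightarrow> S x \<subseteq> fst x \<and> ?ext (S x)"
      by metis
    obtain g where g: "g ` M \<subseteq> edges E" "inj_on (c \<circ> g) M"
        "pairwise (\<lambda>x y. disjnt (fst (g x)) (fst (g y))) M"
    proof (rule rainbow_extension[of M "edges E" r c S])
      show "finite (S x) \<and> card (S x) \<le> r" if "x \<in> M" for x
      proof -
        have "finite (fst x)" "card (fst x) = r" using edge[of x] that by (auto simp: M_def)
        then show ?thesis using S[OF that] by (metis card_mono finite_subset)
      qed
      show "disjnt (S x) (S y)" if "x \<in> M" "y \<in> M" "x \<noteq> y" for x y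
      proof -
        have "disjnt (fst x) (fst y)" using M(3) that by (simp add: pairwise_def)
        then show ?thesis using S that by (meson disjnt_subset1 disjnt_subset2)
      qed
    qed (use M S edge in auto)
    have "inj_on g M" using g(2) by (rule inj_on_imageI2)
    moreover have "inj_on c (g ` M)" using g(2) by (rule inj_on_imageI)
    ultimately have "rainbow_matching t E c (g ` M)"
      using g M
      by (auto simp: rainbow_matching_def t_matching_def matching_def card_image pairwise_def)
    then show False using ex by (auto simp: rainbow_free_example_def)
  qed
  then obtain e where e: "\<And>i. i < f \<Longrightarrow> e i \<in> edges E \<and> c (e i) = i"
      "\<And>i T. i < f \<Longrightarrow> T \<subseteq> fst (e i) \<Longrightarrow> \<not> ?ext T"
    by metis
  have "inj_on e {..<f}" using e(1) by (metis inj_onI lessThan_iff)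
  then have "f = card {y \<in> e ` {..<f}. {} \<subseteq> fst y}" by (simp add: card_image)
  also have "\<dots> \<le> (t - 1) * (r * (t - 1) + 1) ^ r"
  proof (rule card_unextendable_le[where X = "edges E" and c = c and r = r])
    show "finite (fst y) \<and> card (fst y) = r" if "y \<in> e ` {..<f}" for y
      using that e(1) edge by blast
    show "\<not> ?ext T" if "y \<in> e ` {..<f}" "T \<subseteq> fst y" for y T
      using that e(2) by blast
    show "inj_on c (e ` {..<f})"
      by (rule inj_onI) (metis e(1) imageE lessThan_iff)
    show "e ` {..<f} \<subseteq> edges E" using e(1) by blast
  qed simp_all
  finally show ?thesis .
qed

theorem theorem3:
  fixes r t :: nat
  assumes "r \<ge> 2" and "t \<ge> 2"
  shows "max_colors r t < enat ((r + 1) ^ (r + 1) * (t - 1) * t ^ (2 * r))"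
proof -
  let ?B = "(t - 1) * (r * (t - 1) + 1) ^ r"
  have "max_colors r t \<le> enat ?B"
    unfolding max_colors_def by (rule Sup_least) (auto dest: rainbow_free_example_le)
  also have "?B < (r + 1) ^ (r + 1) * (t - 1) * t ^ (2 * r)"
  proof -
    have "r * (t - 1) + 1 \<le> (r + 1) * t"
      using assms add_mono[of "r * (t - 1)" "r * t" 1 t] by (simp add: algebra_simps)
    then have "(r * (t - 1) + 1) ^ r \<le> ((r + 1) * t) ^ r" by (rule power_mono) simp
    also have "\<dots> = (r + 1) ^ r * t ^ r" by (rule power_mult_distrib)
    also have "\<dots> < (r + 1) ^ (r + 1) * t ^ (2 * r)"
    proof (rule mult_less_le_imp_less)
      show "(r + 1) ^ r < (r + 1) ^ (r + 1)" using assms by (intro power_strict_increasing) auto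
      show "t ^ r \<le> t ^ (2 * r)" using assms by (intro power_increasing) auto
    qed (use assms in simp_all)
    finally show ?thesis using assms by (simp add: mult.assoc mult.left_commute)
  qed
  finally show ?thesis by simp
qed

end
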